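(* The reduction relation $\rightarrow_{\beta\pi\sigma\mu\epsilon}$ of $\lambda\mathbf{J}^{\mathbf{mse}}$ is confluent (on all, not necessarily typable, terms): if $t\rightarrow^* t_1$ and $t\rightarrow^* t_2$, then there is $t_3$ with $t_1\rightarrow^* t_3$ and $t_2\rightarrow^* t_3$.
   Context: The calculus $\lambda\mathbf{J}^{\mathbf{mse}}$: terms $t,u,v::= x\mid \lambda x.t\mid \{c\}$; co-terms $l::= []\mid u::l\mid (x)c$; commands $c::= t\,l$. $\lambda x$ binds $x$ in $t$, $(x)$ binds $x$ in $c$; $[t/x]T$ is capture-avoiding substitution. Evaluation contexts $E::=[]\mid u::l$. Append: $[]@l'=l'$, $(u::l)@l'=u::(l@l')$, $((x)\,t\,l)@l'=(x)\,t\,(l@l')$. The reduction $\rightarrow$ is the closure under all constructors of: $(\beta)\ (\lambda x.t)(u::l)\rightarrow u\,((x)\,t\,l)$; $(\pi)\ \{t\,l\}\,E\rightarrow t\,(l@E)$; $(\sigma)\ t\,(x)c\rightarrow [t/x]c$; $(\mu)\ (x)\,x\,l\rightarrow l$ if $x$ not free in $l$; $(\epsilon)\ \{t\,[]\}\rightarrow t$. *)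

theory Defs imports Main begin

text \<open>
  Expressions are represented up to \<open>\<alpha>\<close>-equivalence by de Bruijn indices: \<open>Lam t\<close> is
  \<open>\<lambda>x. t\<close> and \<open>Sel c\<close> is \<open>(x) c\<close>, each binding index 0 in its body. \<open>Coe c\<close> is \<open>{c}\<close>
  and \<open>Cut t l\<close> is the command \<open>t l\<close>.
\<close>

datatype trm = Var nat | Lam trm | Coe cmd
  and cotrm = Empty | Push trm cotrm | Sel cmd
  and cmd = Cut trm cotrm

text \<open>Lifting at \<open>k\<close> increments every free index that is at least \<open>k\<close>.\<close>

primrec lift_trm :: "nat \<Rightarrow> trm \<Rightarrow> trm"
  and lift_cotrm :: "nat \<Rightarrow> cotrm \<Rightarrow> cotrm"
  and lift_cmd :: "nat \<Rightarrow> cmd \<Rightarrow> cmd" where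
  "lift_trm k (Var i) = Var (if i < k then i else Suc i)"
| "lift_trm k (Lam t) = Lam (lift_trm (Suc k) t)"
| "lift_trm k (Coe c) = Coe (lift_cmd k c)"
| "lift_cotrm k Empty = Empty"
| "lift_cotrm k (Push u l) = Push (lift_trm k u) (lift_cotrm k l)"
| "lift_cotrm k (Sel c) = Sel (lift_cmd (Suc k) c)"
| "lift_cmd k (Cut t l) = Cut (lift_trm k t) (lift_cotrm k l)"

text \<open>
  \<open>subst_* s k T\<close> is \<open>[s/k]T\<close>: since the binder of \<open>k\<close> is removed, the free indices
  above \<open>k\<close> are decremented.
\<close>

primrec subst_trm :: "trm \<Rightarrow> nat \<Rightarrow> trm \<Rightarrow> trm"
  and subst_cotrm :: "trm \<Rightarrow> nat \<Rightarrow> cotrm \<Rightarrow> cotrm"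
  and subst_cmd :: "trm \<Rightarrow> nat \<Rightarrow> cmd \<Rightarrow> cmd" where
  "subst_trm s k (Var i) = (if i < k then Var i else if i = k then s else Var (i - 1))"
| "subst_trm s k (Lam t) = Lam (subst_trm (lift_trm 0 s) (Suc k) t)"
| "subst_trm s k (Coe c) = Coe (subst_cmd s k c)"
| "subst_cotrm s k Empty = Empty"
| "subst_cotrm s k (Push u l) = Push (subst_trm s k u) (subst_cotrm s k l)"
| "subst_cotrm s k (Sel c) = Sel (subst_cmd (lift_trm 0 s) (Suc k) c)"
| "subst_cmd s k (Cut t l) = Cut (subst_trm s k t) (subst_cotrm s k l)"

text \<open>In the last clause, \<open>l'\<close> moves under the binder and must not be captured, hence the lifting.\<close>

fun append_cotrm :: "cotrm \<Rightarrow> cotrm \<Rightarrow> cotrm" where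
  "append_cotrm Empty l' = l'"
| "append_cotrm (Push u l) l' = Push u (append_cotrm l l')"
| "append_cotrm (Sel (Cut t l)) l' = Sel (Cut t (append_cotrm l (lift_cotrm 0 l')))"

inductive eval_ctx :: "cotrm \<Rightarrow> bool" where
  "eval_ctx Empty"
| "eval_ctx (Push u l)"

text \<open>
  In \<open>beta\<close>, \<open>l\<close> moves under the selection binder, which by the variable convention does
  not bind in it. In \<open>mu\<close>, the side condition that \<open>x\<close> is not free in the co-term says that
  it has the form \<open>lift_cotrm 0 l\<close>; outside the binder this co-term is \<open>l\<close>.
\<close>

inductive red_trm :: "trm \<Rightarrow> trm \<Rightarrow> bool"
  and red_cotrm :: "cotrm \<Rightarrow> cotrm \<Rightarrow> bool"
  and red_cmd :: "cmd \<Rightarrow> cmd \<Rightarrow> bool" where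
  beta: "red_cmd (Cut (Lam t) (Push u l)) (Cut u (Sel (Cut t (lift_cotrm 0 l))))"
| pi: "eval_ctx E \<Longrightarrow> red_cmd (Cut (Coe (Cut t l)) E) (Cut t (append_cotrm l E))"
| sigma: "red_cmd (Cut t (Sel c)) (subst_cmd t 0 c)"
| mu: "red_cotrm (Sel (Cut (Var 0) (lift_cotrm 0 l))) l"
| epsilon: "red_trm (Coe (Cut t Empty)) t"
| Lam: "red_trm t t' \<Longrightarrow> red_trm (Lam t) (Lam t')"
| Coe: "red_cmd c c' \<Longrightarrow> red_trm (Coe c) (Coe c')"
| Push_left: "red_trm u u' \<Longrightarrow> red_cotrm (Push u l) (Push u' l)"
| Push_right: "red_cotrm l l' \<Longrightarrow> red_cotrm (Push u l) (Push u l')"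
| Sel: "red_cmd c c' \<Longrightarrow> red_cotrm (Sel c) (Sel c')"
| Cut_left: "red_trm t t' \<Longrightarrow> red_cmd (Cut t l) (Cut t' l)"
| Cut_right: "red_cotrm l l' \<Longrightarrow> red_cmd (Cut t l) (Cut t l')"

end

theory Submission imports Defs "HOL-Library.Confluence" begin

text \<open>
  The proof follows Tait and Martin-Loef: a parallel reduction between \<open>\<rightarrow>\<close> and \<open>\<rightarrow>\<^sup>*\<close> is shown to have
  the diamond property. All critical pairs are benign. The overlaps of \<open>\<mu>\<close> with \<open>\<sigma>\<close> and of \<open>\<epsilon>\<close> with
  \<open>\<pi>\<close> are trivial because \<open>[x/x]c = c\<close> and \<open>l @ [] = l\<close>; a redex inside the command of a \<open>\<pi>\<close>-redex
  \<open>{c} E\<close> survives in \<open>c @ E\<close>, since \<open>@\<close> is associative and commutes with substitution, and since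
  \<open>E @ E'\<close> is again an evaluation context. The diamond property goes by induction on size rather than
  on structure, as some pairs of reducts are closed by passing to a smaller expression that is not a
  subexpression, for example \<open>t l\<close> for \<open>t (x) x l\<close>.
\<close>

section \<open>Lifting and substitution\<close>

lemma lift_lift:
  "i \<le> k \<Longrightarrow> lift_trm (Suc k) (lift_trm i t) = lift_trm i (lift_trm k t)"
  "i \<le> k \<Longrightarrow> lift_cotrm (Suc k) (lift_cotrm i l) = lift_cotrm i (lift_cotrm k l)"
  "i \<le> k \<Longrightarrow> lift_cmd (Suc k) (lift_cmd i c) = lift_cmd i (lift_cmd k c)"
  by (induction t and l and c arbitrary: i k and i k and i k
      rule: trm.induct cotrm.induct cmd.induct) auto

text \<open>Index \<open>k\<close> does not occur in an expression lifted at \<open>k\<close>, so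
  the substitution only undoes the shift. In particular \<open>[t/x](x l)\<close> is
  \<open>t l\<close> for the body \<open>x l\<close> of a \<mu>-redex.\<close>

lemma subst_lift [simp]:
  "subst_trm s k (lift_trm k t) = t"
  "subst_cotrm s k (lift_cotrm k l) = l"
  "subst_cmd s k (lift_cmd k c) = c"
  by (induction t and l and c arbitrary: s k and s k and s k) auto

lemma lift_inject [simp]:
  "lift_trm k t = lift_trm k t' \<longleftrightarrow> t = t'"
  "lift_cotrm k l = lift_cotrm k l' \<longleftrightarrow> l = l'"
  "lift_cmd k c = lift_cmd k c' \<longleftrightarrow> c = c'"
  by (metis subst_lift)+

text \<open>While the binder of \<open>i\<close> is still present, positions above it are counted
  one higher, hence \<open>Suc k\<close> inside. The opposite order of the two positions is
  \<open>lift_subst_le\<close>.\<close>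

lemma lift_subst_ge:
  "i \<le> k \<Longrightarrow> lift_trm k (subst_trm s i t) = subst_trm (lift_trm k s) i (lift_trm (Suc k) t)"
  "i \<le> k \<Longrightarrow> lift_cotrm k (subst_cotrm s i l) = subst_cotrm (lift_trm k s) i (lift_cotrm (Suc k) l)"
  "i \<le> k \<Longrightarrow> lift_cmd k (subst_cmd s i c) = subst_cmd (lift_trm k s) i (lift_cmd (Suc k) c)"
  by (induction t and l and c arbitrary: s i k and s i k and s i k) (auto simp: lift_lift)

lemma lift_subst_le:
  "i \<le> k \<Longrightarrow> lift_trm i (subst_trm s k t) = subst_trm (lift_trm i s) (Suc k) (lift_trm i t)"
  "i \<le> k \<Longrightarrow> lift_cotrm i (subst_cotrm s k l) = subst_cotrm (lift_trm i s) (Suc k) (lift_cotrm i l)"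
  "i \<le> k \<Longrightarrow> lift_cmd i (subst_cmd s k c) = subst_cmd (lift_trm i s) (Suc k) (lift_cmd i c)"
  by (induction t and l and c arbitrary: s i k and s i k and s i k) (auto simp: lift_lift)

text \<open>The substitution lemma in de Bruijn form; it makes \<sigma>-contraction compatible with
  substitution.\<close>

lemma subst_subst:
  "i \<le> k \<Longrightarrow> subst_trm s k (subst_trm u i t)
    = subst_trm (subst_trm s k u) i (subst_trm (lift_trm i s) (Suc k) t)"
  "i \<le> k \<Longrightarrow> subst_cotrm s k (subst_cotrm u i l)
    = subst_cotrm (subst_trm s k u) i (subst_cotrm (lift_trm i s) (Suc k) l)"
  "i \<le> k \<Longrightarrow> subst_cmd s k (subst_cmd u i c)
    = subst_cmd (subst_trm s k u) i (subst_cmd (lift_trm i s) (Suc k) c)"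
  by (induction t and l and c arbitrary: s u i k and s u i k and s u i k)
    (auto simp: lift_lift lift_subst_le)

text \<open>This is \<open>[x/x]c = c\<close>. Lifting at \<open>Suc k\<close> vacates index
  \<open>Suc k\<close>, and substituting \<open>Var k\<close> for \<open>k\<close> closes the gap,
  so that the outer variable takes the place of the inner one.\<close>

lemma subst_lift_Var0:
  "subst_trm (Var k) k (lift_trm (Suc k) t) = t"
  "subst_cotrm (Var k) k (lift_cotrm (Suc k) l) = l"
  "subst_cmd (Var k) k (lift_cmd (Suc k) c) = c"
  by (induction t and l and c arbitrary: k and k and k) auto

text \<open>Serves the induction on size: a \<mu>-redex contains its contractum only in lifted
  form.\<close>

lemma size_lift [simp]:
  "size (lift_trm k t) = size t"
  "size (lift_cotrm k l) = size l"
  "size (lift_cmd k c) = size c"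
  by (induction t and l and c arbitrary: k and k and k) auto

section \<open>Inversion of liftings\<close>

lemma lift_eq_iff:
  "lift_trm k t = Lam u \<longleftrightarrow> (\<exists>t'. t = Lam t' \<and> u = lift_trm (Suc k) t')"
  "lift_trm k t = Coe c \<longleftrightarrow> (\<exists>c'. t = Coe c' \<and> c = lift_cmd k c')"
  "lift_cotrm k l = Empty \<longleftrightarrow> l = Empty"
  "lift_cotrm k l = Push u m \<longleftrightarrow> (\<exists>u' m'. l = Push u' m' \<and> u = lift_trm k u' \<and> m = lift_cotrm k m')"
  "lift_cotrm k l = Sel c \<longleftrightarrow> (\<exists>c'. l = Sel c' \<and> c = lift_cmd (Suc k) c')"
  "lift_cmd k d = Cut u m \<longleftrightarrow> (\<exists>u' m'. d = Cut u' m' \<and> u = lift_trm k u' \<and> m = lift_cotrm k m')"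
  "lift_trm (Suc k) t = Var 0 \<longleftrightarrow> t = Var 0"
  by (cases t; auto; fail | cases l; auto; fail | cases d; auto; fail)+

lemmas lift_eq_iff' = lift_eq_iff[THEN eq_iff_swap]

text \<open>The \<open>\<mu>\<close>-rule needs this: \<open>lift_cotrm 0 l\<close> has to be recognised below a further lifting.\<close>

lemma lift_eq_lift:
  "i \<le> k \<Longrightarrow> lift_trm (Suc k) t = lift_trm i t' \<Longrightarrow> \<exists>u. t = lift_trm i u \<and> t' = lift_trm k u"
  "i \<le> k \<Longrightarrow> lift_cotrm (Suc k) l = lift_cotrm i l' \<Longrightarrow> \<exists>m. l = lift_cotrm i m \<and> l' = lift_cotrm k m"
  "i \<le> k \<Longrightarrow> lift_cmd (Suc k) c = lift_cmd i c' \<Longrightarrow> \<exists>d. c = lift_cmd i d \<and> c' = lift_cmd k d"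
proof (induction t and l and c arbitrary: i k t' and i k l' and i k c')
  case (Var n)
  then obtain m where "t' = Var m" by (cases t') auto
  with Var show ?case
    \<comment> \<open>The witness undoes the lifting at \<open>i\<close>. The value
      \<open>n = i\<close> cannot occur: being below \<open>Suc k\<close> it is unchanged on the
      left, and no lifting at \<open>i\<close> produces it.\<close>
    by (intro exI[of _ "Var (if n < i then n else n - 1)"]) (auto split: if_splits)
next
  case (Lam t)
  then obtain s where s: "t' = Lam s" "lift_trm (Suc (Suc k)) t = lift_trm (Suc i) s"
    by (auto simp: lift_eq_iff')
  with Lam.IH[of "Suc i" "Suc k" s] Lam.prems(1) obtain u where
    "t = lift_trm (Suc i) u" "s = lift_trm (Suc k) u" by auto
  with s show ?case by (intro exI[of _ "Lam u"]) simp
next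
  case (Coe c)
  then obtain d where d: "t' = Coe d" "lift_cmd (Suc k) c = lift_cmd i d"
    by (auto simp: lift_eq_iff')
  with Coe.IH[of i k d] Coe.prems(1) obtain e where
    "c = lift_cmd i e" "d = lift_cmd k e" by auto
  with d show ?case by (intro exI[of _ "Coe e"]) simp
next
  case Empty
  then show ?case by (intro exI[of _ Empty]) (auto simp: lift_eq_iff')
next
  case (Push u l)
  then obtain v m where m: "l' = Push v m" "lift_trm (Suc k) u = lift_trm i v"
    "lift_cotrm (Suc k) l = lift_cotrm i m"
    by (auto simp: lift_eq_iff')
  with Push.IH(1)[of i k v] Push.IH(2)[of i k m] Push.prems(1) obtain w n where
    "u = lift_trm i w" "v = lift_trm k w" "l = lift_cotrm i n" "m = lift_cotrm k n" by auto
  with m show ?case by (intro exI[of _ "Push w n"]) simp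
next
  case (Sel c)
  then obtain d where d: "l' = Sel d" "lift_cmd (Suc (Suc k)) c = lift_cmd (Suc i) d"
    by (auto simp: lift_eq_iff')
  with Sel.IH[of "Suc i" "Suc k" d] Sel.prems(1) obtain e where
    "c = lift_cmd (Suc i) e" "d = lift_cmd (Suc k) e" by auto
  with d show ?case by (intro exI[of _ "Sel e"]) simp
next
  case (Cut u l)
  then obtain v m where m: "c' = Cut v m" "lift_trm (Suc k) u = lift_trm i v"
    "lift_cotrm (Suc k) l = lift_cotrm i m"
    by (auto simp: lift_eq_iff')
  with Cut.IH(1)[of i k v] Cut.IH(2)[of i k m] Cut.prems(1) obtain w n where
    "u = lift_trm i w" "v = lift_trm k w" "l = lift_cotrm i n" "m = lift_cotrm k n" by auto
  with m show ?case by (intro exI[of _ "Cut w n"]) simp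
qed

section \<open>Append and evaluation contexts\<close>

text \<open>With append available on commands, the clause for selections needs no case split, and
  mutual inductions have a statement for commands.\<close>

primrec append_cmd :: "cmd \<Rightarrow> cotrm \<Rightarrow> cmd" where
  "append_cmd (Cut t l) l' = Cut t (append_cotrm l l')"

lemma append_Sel [simp]: "append_cotrm (Sel c) l = Sel (append_cmd c (lift_cotrm 0 l))"
  by (cases c) simp

declare append_cotrm.simps(3) [simp del]

lemma lift_append:
  "lift_cotrm k (append_cotrm l l') = append_cotrm (lift_cotrm k l) (lift_cotrm k l')"
  "lift_cmd k (append_cmd c l') = append_cmd (lift_cmd k c) (lift_cotrm k l')"
  \<comment> \<open>Append never enters a term, so the predicate for terms in the mutual induction
    is trivial.\<close>
  by (induction l and c arbitrary: k l' and k l'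
      rule: cotrm.induct[where ?P1.0 = "\<lambda>_. True"] cmd.induct[where ?P1.0 = "\<lambda>_. True"]) (auto simp: lift_lift)

lemma subst_append:
  "subst_cotrm s k (append_cotrm l l') = append_cotrm (subst_cotrm s k l) (subst_cotrm s k l')"
  "subst_cmd s k (append_cmd c l') = append_cmd (subst_cmd s k c) (subst_cotrm s k l')"
  by (induction l and c arbitrary: s k l' and s k l'
      rule: cotrm.induct[where ?P1.0 = "\<lambda>_. True"] cmd.induct[where ?P1.0 = "\<lambda>_. True"]) (auto simp: lift_subst_le)

lemma append_Empty [simp]:
  "append_cotrm l Empty = l"
  "append_cmd c Empty = c"
  by (induction l and c
      rule: cotrm.induct[where ?P1.0 = "\<lambda>_. True"] cmd.induct[where ?P1.0 = "\<lambda>_. True"]) auto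

lemma append_assoc:
  "append_cotrm (append_cotrm l l') l'' = append_cotrm l (append_cotrm l' l'')"
  "append_cmd (append_cmd c l') l'' = append_cmd c (append_cotrm l' l'')"
  by (induction l and c arbitrary: l' l'' and l' l''
      rule: cotrm.induct[where ?P1.0 = "\<lambda>_. True"] cmd.induct[where ?P1.0 = "\<lambda>_. True"]) (auto simp: lift_append)

lemma eval_ctx_lift [simp]: "eval_ctx (lift_cotrm k E) \<longleftrightarrow> eval_ctx E"
  by (cases E) (auto simp: eval_ctx.simps)

lemma eval_ctx_subst: "eval_ctx E \<Longrightarrow> eval_ctx (subst_cotrm s k E)"
  by (cases E) (auto simp: eval_ctx.simps)

text \<open>Appending \<open>E'\<close> to a \<pi>-redex \<open>{c} E\<close> has to give a
  \<pi>-redex again.\<close>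

lemma eval_ctx_append: "eval_ctx E \<Longrightarrow> eval_ctx E' \<Longrightarrow> eval_ctx (append_cotrm E E')"
  by (cases E) (auto simp: eval_ctx.simps)

section \<open>Parallel reduction\<close>

text \<open>
  In \<open>par_pi\<close> the whole command \<open>c\<close> reduces before \<open>E'\<close> is appended, so that a nest of
  \<open>\<pi>\<close>-redexes \<open>{{t l} E} E'\<close> can be contracted in one parallel step.
\<close>

inductive par_trm :: "trm \<Rightarrow> trm \<Rightarrow> bool"
  and par_cotrm :: "cotrm \<Rightarrow> cotrm \<Rightarrow> bool"
  and par_cmd :: "cmd \<Rightarrow> cmd \<Rightarrow> bool" where
  par_Var: "par_trm (Var i) (Var i)"
| par_Lam: "par_trm t t' \<Longrightarrow> par_trm (Lam t) (Lam t')"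
| par_Coe: "par_cmd c c' \<Longrightarrow> par_trm (Coe c) (Coe c')"
| par_epsilon: "par_trm t t' \<Longrightarrow> par_trm (Coe (Cut t Empty)) t'"
| par_Empty: "par_cotrm Empty Empty"
| par_Push: "par_trm u u' \<Longrightarrow> par_cotrm l l' \<Longrightarrow> par_cotrm (Push u l) (Push u' l')"
| par_Sel: "par_cmd c c' \<Longrightarrow> par_cotrm (Sel c) (Sel c')"
| par_mu: "par_cotrm l l' \<Longrightarrow> par_cotrm (Sel (Cut (Var 0) (lift_cotrm 0 l))) l'"
| par_Cut: "par_trm t t' \<Longrightarrow> par_cotrm l l' \<Longrightarrow> par_cmd (Cut t l) (Cut t' l')"
| par_beta: "par_trm t t' \<Longrightarrow> par_trm u u' \<Longrightarrow> par_cotrm l l' \<Longrightarrow>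
    par_cmd (Cut (Lam t) (Push u l)) (Cut u' (Sel (Cut t' (lift_cotrm 0 l'))))"
| par_pi: "eval_ctx E \<Longrightarrow> par_cmd c c' \<Longrightarrow> par_cotrm E E' \<Longrightarrow>
    par_cmd (Cut (Coe c) E) (append_cmd c' E')"
| par_sigma: "par_trm t t' \<Longrightarrow> par_cmd c c' \<Longrightarrow> par_cmd (Cut t (Sel c)) (subst_cmd t' 0 c')"

inductive_cases par_VarE [elim!]: "par_trm (Var i) t"
inductive_cases par_LamE [elim!]: "par_trm (Lam t) u"
inductive_cases par_CoeE [consumes 1, case_names cong epsilon]: "par_trm (Coe c) u"
inductive_cases par_EmptyE [elim!]: "par_cotrm Empty m"
inductive_cases par_PushE [elim!]: "par_cotrm (Push u l) m"
inductive_cases par_SelE [consumes 1, case_names cong mu]: "par_cotrm (Sel c) m"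
inductive_cases par_CutE [consumes 1, case_names cong beta pi sigma]: "par_cmd (Cut t l) d"

lemma par_refl [simp, intro]: "par_trm t t" "par_cotrm l l" "par_cmd c c"
  by (induction t and l and c) (auto intro: par_trm_par_cotrm_par_cmd.intros)

text \<open>Only \<mu> changes the outermost form of a co-term, and it applies to selections alone.
  Hence a \<pi>-redex remains one when its context reduces.\<close>

lemma eval_ctx_par: "eval_ctx E \<Longrightarrow> par_cotrm E E' \<Longrightarrow> eval_ctx E'"
  by (auto simp: eval_ctx.simps)

section \<open>Compatibility with lifting, substitution and append\<close>

lemma par_lift:
  "par_trm t t' \<Longrightarrow> par_trm (lift_trm k t) (lift_trm k t')"
  "par_cotrm l l' \<Longrightarrow> par_cotrm (lift_cotrm k l) (lift_cotrm k l')"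
  "par_cmd c c' \<Longrightarrow> par_cmd (lift_cmd k c) (lift_cmd k c')"
proof (induction arbitrary: k and k and k rule: par_trm_par_cotrm_par_cmd.inducts)
  case (par_beta t t' u u' l l')
  then show ?case
    using par_trm_par_cotrm_par_cmd.par_beta[of "lift_trm (Suc k) t" "lift_trm (Suc k) t'"]
    by (simp add: lift_lift)
qed (auto simp: lift_lift lift_append lift_subst_ge intro: par_trm_par_cotrm_par_cmd.intros)

lemma par_subst:
  "par_trm t t' \<Longrightarrow> par_trm s s' \<Longrightarrow> par_trm (subst_trm s k t) (subst_trm s' k t')"
  "par_cotrm l l' \<Longrightarrow> par_trm s s' \<Longrightarrow> par_cotrm (subst_cotrm s k l) (subst_cotrm s' k l')"
  "par_cmd c c' \<Longrightarrow> par_trm s s' \<Longrightarrow> par_cmd (subst_cmd s k c) (subst_cmd s' k c')"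
proof (induction arbitrary: s s' k and s s' k and s s' k rule: par_trm_par_cotrm_par_cmd.inducts)
  case (par_beta t t' u u' l l')
  then show ?case
    using par_trm_par_cotrm_par_cmd.par_beta[of "subst_trm (lift_trm 0 s) (Suc k) t" "subst_trm (lift_trm 0 s') (Suc k) t'"]
    by (simp add: par_lift flip: lift_subst_le)
next
  case (par_mu l l')
  then show ?case
    \<comment> \<open>Under the binder the substitution acts at \<open>Suc k\<close>: it fixes index
      0 and commutes with lifting at 0, so the \<mu>-redex keeps its shape.\<close>
    using par_trm_par_cotrm_par_cmd.par_mu[of "subst_cotrm s k l" "subst_cotrm s' k l'"]
    by (simp add: lift_subst_le)
qed (auto simp: par_lift subst_append eval_ctx_subst subst_subst intro: par_trm_par_cotrm_par_cmd.intros)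

text \<open>The requirement on \<open>E\<close> matters for a \<pi>-redex \<open>{c} E0\<close>
  inside: if \<open>E0\<close> is empty, \<open>E\<close> itself becomes the context of that redex.
  Nested \<pi>-steps then agree by associativity of append.\<close>

lemma par_append:
  "par_cotrm l l' \<Longrightarrow> eval_ctx E \<Longrightarrow> par_cotrm E E' \<Longrightarrow> par_cotrm (append_cotrm l E) (append_cotrm l' E')"
  "par_cmd c c' \<Longrightarrow> eval_ctx E \<Longrightarrow> par_cotrm E E' \<Longrightarrow> par_cmd (append_cmd c E) (append_cmd c' E')"
proof (induction arbitrary: E E' and E E' rule: par_trm_par_cotrm_par_cmd.inducts(2,3)[where ?P1.0 = "\<lambda>_ _. True"])
  case (par_mu l l')
  then show ?case
    using par_trm_par_cotrm_par_cmd.par_mu[of "append_cotrm l E" "append_cotrm l' E'"]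
    by (simp add: lift_append)
next
  case (par_beta t t' u u' l l')
  then show ?case
    by (simp flip: lift_append) (rule par_trm_par_cotrm_par_cmd.par_beta; simp)
next
  case (par_pi E0 c c' E0')
  then show ?case
    by (auto simp: append_assoc eval_ctx_append intro: par_trm_par_cotrm_par_cmd.par_pi)
next
  case (par_sigma t t' c c')
  then show ?case
    \<comment> \<open>Under the binder \<open>E'\<close> occurs lifted, so the substitution
      performed by \<sigma> gives back \<open>E'\<close> unchanged.\<close>
    using par_trm_par_cotrm_par_cmd.par_sigma[of t t' "append_cmd c (lift_cotrm 0 E)" "append_cmd c' (lift_cotrm 0 E')"]
    by (simp add: subst_append par_lift)
qed (auto simp: par_lift intro: par_trm_par_cotrm_par_cmd.intros)

text \<open>Reduction creates no free variables. This keeps the side condition of \<mu> true when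
  the co-term inside a \<mu>-redex is reduced.\<close>

lemma par_lift_inv:
  "par_trm x y \<Longrightarrow> x = lift_trm k t \<Longrightarrow> \<exists>t'. y = lift_trm k t' \<and> par_trm t t'"
  "par_cotrm p q \<Longrightarrow> p = lift_cotrm k l \<Longrightarrow> \<exists>l'. q = lift_cotrm k l' \<and> par_cotrm l l'"
  "par_cmd a b \<Longrightarrow> a = lift_cmd k c \<Longrightarrow> \<exists>c'. b = lift_cmd k c' \<and> par_cmd c c'"
proof (induction arbitrary: k t and k l and k c rule: par_trm_par_cotrm_par_cmd.inducts)
  case (par_Var i)
  then show ?case by (metis par_refl(1))
next
  case (par_Lam x y)
  then show ?case
    by (clarsimp simp: lift_eq_iff') (metis lift_trm.simps(2) par_trm_par_cotrm_par_cmd.par_Lam)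
next
  case (par_Coe x y)
  then show ?case
    by (clarsimp simp: lift_eq_iff') (metis lift_trm.simps(3) par_trm_par_cotrm_par_cmd.par_Coe)
next
  case (par_epsilon x y)
  then show ?case
    by (clarsimp simp: lift_eq_iff') (metis par_trm_par_cotrm_par_cmd.par_epsilon)
next
  case par_Empty
  then show ?case by (auto simp: lift_eq_iff')
next
  case (par_Push u u' p q)
  then show ?case
    by (clarsimp simp: lift_eq_iff') (metis lift_cotrm.simps(2) par_trm_par_cotrm_par_cmd.par_Push)
next
  case (par_Sel x y)
  then show ?case
    by (clarsimp simp: lift_eq_iff') (metis lift_cotrm.simps(3) par_trm_par_cotrm_par_cmd.par_Sel)
next
  case (par_mu p q)
  then obtain m where l: "l = Sel (Cut (Var 0) m)" "lift_cotrm (Suc k) m = lift_cotrm 0 p"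
    by (auto simp: lift_eq_iff' lift_eq_iff)
  \<comment> \<open>The position \<open>k\<close> and the bound variable of the \<mu>-redex are both
    absent, so both liftings factor through a common \<open>n\<close>. Thus \<open>l\<close> is
    itself a \<mu>-redex, and the induction hypothesis applies to \<open>n\<close>.\<close>
  then obtain n where "m = lift_cotrm 0 n" "p = lift_cotrm k n"
    using lift_eq_lift(2) by blast
  with l par_mu.IH show ?case
    by (metis par_trm_par_cotrm_par_cmd.par_mu)
next
  case (par_Cut x y p q)
  then show ?case
    by (clarsimp simp: lift_eq_iff') (metis lift_cmd.simps par_trm_par_cotrm_par_cmd.par_Cut)
next
  case (par_beta x x' u u' p p')
  from par_beta.prems obtain t0 u0 l0 where c: "c = Cut (Lam t0) (Push u0 l0)"
    "x = lift_trm (Suc k) t0" "u = lift_trm k u0" "p = lift_cotrm k l0"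
    by (auto simp: lift_eq_iff')
  with par_beta.IH obtain t1 u1 l1 where
    "x' = lift_trm (Suc k) t1" "par_trm t0 t1" "u' = lift_trm k u1" "par_trm u0 u1"
    "p' = lift_cotrm k l1" "par_cotrm l0 l1" by metis
  with c show ?case
    by (intro exI[of _ "Cut u1 (Sel (Cut t1 (lift_cotrm 0 l1)))"])
      (auto simp: lift_lift intro: par_trm_par_cotrm_par_cmd.intros)
next
  case (par_pi E a a' E')
  from par_pi.prems obtain c0 E0 where c: "c = Cut (Coe c0) E0"
    "a = lift_cmd k c0" "E = lift_cotrm k E0"
    by (auto simp: lift_eq_iff')
  with par_pi.IH obtain c1 E1 where
    "a' = lift_cmd k c1" "par_cmd c0 c1" "E' = lift_cotrm k E1" "par_cotrm E0 E1" by metis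
  with c par_pi.hyps show ?case
    by (intro exI[of _ "append_cmd c1 E1"])
      (auto simp: lift_append intro: par_trm_par_cotrm_par_cmd.intros)
next
  case (par_sigma x x' a a')
  from par_sigma.prems obtain t0 c0 where c: "c = Cut t0 (Sel c0)"
    "x = lift_trm k t0" "a = lift_cmd (Suc k) c0"
    by (auto simp: lift_eq_iff')
  with par_sigma.IH obtain t1 c1 where
    "x' = lift_trm k t1" "par_trm t0 t1" "a' = lift_cmd (Suc k) c1" "par_cmd c0 c1" by metis
  with c show ?case
    by (intro exI[of _ "subst_cmd t1 0 c1"])
      (auto simp: lift_subst_ge intro: par_trm_par_cotrm_par_cmd.intros)
qed

section \<open>The diamond property\<close>

text \<open>One induction on \<open>n\<close> covers all three sorts, because smaller expressions
  may be of another sort. The pairs of a congruence step with a contraction at the root are settled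
  first, in one orientation, and used in both.\<close>

lemma diamond_aux:
  "(\<forall>t t1 t2. size t = n \<longrightarrow> par_trm t t1 \<longrightarrow> par_trm t t2 \<longrightarrow> (\<exists>t3. par_trm t1 t3 \<and> par_trm t2 t3))
   \<and> (\<forall>l l1 l2. size l = n \<longrightarrow> par_cotrm l l1 \<longrightarrow> par_cotrm l l2 \<longrightarrow> (\<exists>l3. par_cotrm l1 l3 \<and> par_cotrm l2 l3))
   \<and> (\<forall>c c1 c2. size c = n \<longrightarrow> par_cmd c c1 \<longrightarrow> par_cmd c c2 \<longrightarrow> (\<exists>c3. par_cmd c1 c3 \<and> par_cmd c2 c3))"
proof (induction n rule: less_induct)
  case (less n)
  have IHt: "\<exists>t3. par_trm t1 t3 \<and> par_trm t2 t3"
    if "size t < n" "par_trm t t1" "par_trm t t2" for t t1 t2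
    using less that by blast
  have IHl: "\<exists>l3. par_cotrm l1 l3 \<and> par_cotrm l2 l3"
    if "size l < n" "par_cotrm l l1" "par_cotrm l l2" for l l1 l2
    using less that by blast
  have IHc: "\<exists>c3. par_cmd c1 c3 \<and> par_cmd c2 c3"
    if "size c < n" "par_cmd c c1" "par_cmd c c2" for c c1 c2
    using less that by blast

  have Coe_epsilon: "\<exists>t3. par_trm (Coe c1) t3 \<and> par_trm t2 t3"
    if n: "size (Coe (Cut t Empty)) = n" and c1: "par_cmd (Cut t Empty) c1" and t2: "par_trm t t2" for t c1 t2
    using c1
  proof (cases rule: par_CutE)
    case (cong t1 l1)
    with IHt[of t t1 t2] n t2 show ?thesis
      by (auto intro: par_epsilon)
  next
    case (pi c c')
    \<comment> \<open>The term \<open>t\<close> is \<open>Coe c\<close>, and appending the empty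
      co-term changes nothing. So \<open>Coe c1\<close> is a reduct of \<open>t\<close> itself, and
      the hypothesis for \<open>t\<close> applies.\<close>
    then have "par_trm t (Coe c')" "c1 = c'" by (auto intro: par_Coe)
    with IHt[of t "Coe c'" t2] n t2 show ?thesis by auto
  qed auto

  have trm: "\<exists>t3. par_trm t1 t3 \<and> par_trm t2 t3"
    if n: "size t = n" and t1: "par_trm t t1" and t2: "par_trm t t2" for t t1 t2
  proof (cases t)
    case (Coe c)
    from t1[unfolded Coe] show ?thesis
    proof (cases rule: par_CoeE)
      case c1: (cong c1)
      from t2[unfolded Coe] show ?thesis
      proof (cases rule: par_CoeE)
        case (cong c2)
        with c1 IHc[of c c1 c2] n Coe show ?thesis by (auto intro: par_Coe)
      next
        case (epsilon u)
        with c1 Coe_epsilon n Coe show ?thesis by blast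
      qed
    next
      case c1: (epsilon u)
      from t2[unfolded Coe] show ?thesis
      proof (cases rule: par_CoeE)
        case (cong c2)
        with c1 Coe_epsilon n Coe show ?thesis by blast
      next
        case (epsilon u)
        with c1 IHt[of u t1 t2] n Coe show ?thesis by auto
      qed
    qed
  next
    case (Lam u)
    with t1 t2 obtain u1 u2 where "t1 = Lam u1" "t2 = Lam u2" "par_trm u u1" "par_trm u u2" by auto
    with IHt[of u u1 u2] n Lam show ?thesis by (auto intro: par_Lam)
  qed (use t1 t2 in auto)

  have Sel_mu: "\<exists>l3. par_cotrm (Sel c1) l3 \<and> par_cotrm l2 l3"
    if n: "size (Sel (Cut (Var 0) (lift_cotrm 0 l))) = n"
      and c1: "par_cmd (Cut (Var 0) (lift_cotrm 0 l)) c1" and l2: "par_cotrm l l2" for l c1 l2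
    using c1
  proof (cases rule: par_CutE)
    case (cong t1 m)
    \<comment> \<open>The reduct of the lifted co-term is again lifted, so \<mu> still applies to
      \<open>Sel c1\<close>.\<close>
    from par_lift_inv(2)[OF cong(3) refl] obtain l1 where "m = lift_cotrm 0 l1" "par_cotrm l l1" by blast
    with cong IHl[of l l1 l2] n l2 show ?thesis by (auto intro: par_mu)
  next
    case (sigma t1 c c')
    then obtain d where d: "l = Sel d" "c = lift_cmd (Suc 0) d" by (auto simp: lift_eq_iff)
    with par_lift_inv(3)[OF sigma(4)] obtain d' where "c' = lift_cmd (Suc 0) d'" "par_cmd d d'" by blast
    \<comment> \<open>The inner \<sigma>-step only replaces a variable by itself, whence
      \<open>Sel c1\<close> is already a reduct of \<open>l\<close>.\<close>
    with sigma d have "c1 = d'" "par_cotrm l (Sel d')"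
      by (auto simp: subst_lift_Var0 intro: par_Sel)
    with IHl[of l "Sel d'" l2] n l2 show ?thesis by auto
  qed auto

  have cotrm: "\<exists>l3. par_cotrm l1 l3 \<and> par_cotrm l2 l3"
    if n: "size l = n" and l1: "par_cotrm l l1" and l2: "par_cotrm l l2" for l l1 l2
  proof (cases l)
    case Empty
    with l1 l2 show ?thesis by auto
  next
    case (Push u m)
    with l1 l2 obtain u1 m1 u2 m2 where "l1 = Push u1 m1" "par_trm u u1" "par_cotrm m m1"
      "l2 = Push u2 m2" "par_trm u u2" "par_cotrm m m2" by auto
    with IHt[of u u1 u2] IHl[of m m1 m2] n Push show ?thesis by (auto intro: par_Push)
  next
    case (Sel c)
    from l1[unfolded Sel] show ?thesis
    proof (cases rule: par_SelE)
      case c1: (cong c1)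
      from l2[unfolded Sel] show ?thesis
      proof (cases rule: par_SelE)
        case (cong c2)
        with c1 IHc[of c c1 c2] n Sel show ?thesis by (auto intro: par_Sel)
      next
        case (mu m)
        with c1 Sel_mu[of m] n Sel show ?thesis by blast
      qed
    next
      case c1: (mu m)
      from l2[unfolded Sel] show ?thesis
      proof (cases rule: par_SelE)
        case (cong c2)
        with c1 Sel_mu[of m] n Sel show ?thesis by blast
      next
        case (mu m')
        with c1 IHl[of m l1 l2] n Sel show ?thesis by auto
      qed
    qed
  qed

  have Cut_beta: "\<exists>c3. par_cmd (Cut v2 m2) c3 \<and> par_cmd (Cut u1 (Sel (Cut t1 (lift_cotrm 0 l1)))) c3"
    if n: "size (Cut (Lam t) (Push u l)) = n" and t1: "par_trm t t1" "par_trm u u1" "par_cotrm l l1"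
      and t2: "par_trm (Lam t) v2" "par_cotrm (Push u l) m2" for t u l t1 u1 l1 v2 m2
  proof -
    from t2 obtain t2 u2 l2 where 2: "v2 = Lam t2" "m2 = Push u2 l2"
      "par_trm t t2" "par_trm u u2" "par_cotrm l l2" by auto
    obtain t3 u3 l3 where 3: "par_trm t1 t3" "par_trm u1 u3" "par_cotrm l1 l3"
      "par_trm t2 t3" "par_trm u2 u3" "par_cotrm l2 l3"
      using IHt[of t t1 t2] IHt[of u u1 u2] IHl[of l l1 l2] n t1 2 by auto
    have "par_cmd (Cut v2 m2) (Cut u3 (Sel (Cut t3 (lift_cotrm 0 l3))))"
      unfolding 2 using 3 by (intro par_beta)
    moreover have "par_cmd (Cut u1 (Sel (Cut t1 (lift_cotrm 0 l1)))) (Cut u3 (Sel (Cut t3 (lift_cotrm 0 l3))))"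
      using 3 by (intro par_Cut par_Sel par_lift)
    ultimately show ?thesis by blast
  qed

  have Cut_pi: "\<exists>c3. par_cmd (Cut t2 E2) c3 \<and> par_cmd (append_cmd c1 E1) c3"
    if n: "size (Cut (Coe c) E) = n" and E: "eval_ctx E" and 1: "par_cmd c c1" "par_cotrm E E1"
      and t2: "par_trm (Coe c) t2" and E2: "par_cotrm E E2" for c E c1 E1 t2 E2
    using t2
  proof (cases rule: par_CoeE)
    case c2: (cong c2)
    obtain c3 E3 where "par_cmd c1 c3" "par_cmd c2 c3" "par_cotrm E1 E3" "par_cotrm E2 E3"
      using IHc[of c c1 c2] IHl[of E E1 E2] n 1 c2 E2 by auto
    \<comment> \<open>One side can still contract by \<pi>, as \<open>E2\<close> is an evaluation
      context; on the other side the reductions of \<open>c1\<close> and \<open>E1\<close> combine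
      under append.\<close>
    with c2 eval_ctx_par[OF E 1(2)] eval_ctx_par[OF E E2] show ?thesis
      by (auto intro: par_pi par_append)
  next
    case (epsilon t)
    \<comment> \<open>Appending \<open>E\<close> to \<open>Cut t Empty\<close> gives
      \<open>Cut t E\<close>. Both sides are reducts of this smaller command.\<close>
    with par_append(2)[OF 1(1) E 1(2)] have "par_cmd (Cut t E) (append_cmd c1 E1)" by simp
    moreover from epsilon E2 have "par_cmd (Cut t E) (Cut t2 E2)" by (auto intro: par_Cut)
    ultimately show ?thesis using IHc[of "Cut t E"] n epsilon by auto
  qed

  have Cut_sigma: "\<exists>c3. par_cmd (Cut t2 m) c3 \<and> par_cmd (subst_cmd t1 0 c1) c3"
    if n: "size (Cut t (Sel c)) = n" and 1: "par_trm t t1" "par_cmd c c1"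
      and t2: "par_trm t t2" and m: "par_cotrm (Sel c) m" for t c t1 c1 t2 m
    using m
  proof (cases rule: par_SelE)
    case c2: (cong c2)
    obtain t3 c3 where "par_trm t1 t3" "par_trm t2 t3" "par_cmd c1 c3" "par_cmd c2 c3"
      using IHt[of t t1 t2] IHc[of c c1 c2] n 1 c2 t2 by auto
    with c2 show ?thesis by (auto intro: par_sigma par_subst)
  next
    case (mu l)
    \<comment> \<open>Substituting \<open>t\<close> in the body of the \<mu>-redex gives
      \<open>Cut t l\<close>, a smaller command of which both sides are reducts.\<close>
    with par_subst(3)[OF 1(2,1), of 0] have "par_cmd (Cut t l) (subst_cmd t1 0 c1)" by simp
    moreover from mu t2 have "par_cmd (Cut t l) (Cut t2 m)" by (auto intro: par_Cut)
    ultimately show ?thesis using IHc[of "Cut t l"] n mu by auto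
  qed

  have cmd: "\<exists>c3. par_cmd c1 c3 \<and> par_cmd c2 c3"
    if n: "size c = n" and c1: "par_cmd c c1" and c2: "par_cmd c c2" for c c1 c2
  proof -
    obtain t l where c: "c = Cut t l" by (cases c)
    from c1[unfolded c] show ?thesis
    proof (cases rule: par_CutE)
      case r1: (cong t1 l1)
      from c2[unfolded c] show ?thesis
      proof (cases rule: par_CutE)
        case (cong t2 l2)
        with r1 IHt[of t t1 t2] IHl[of l l1 l2] n c show ?thesis by (auto intro: par_Cut)
      next
        case (beta t0 t2 u u2 l0 l2)
        with r1 Cut_beta[of t0 u l0 t2 u2 l2 t1 l1] n c show ?thesis by auto
      next
        case (pi d d2 E2)
        with r1 Cut_pi[of d l d2 E2 t1 l1] n c show ?thesis by auto
      next
        case (sigma t2 d d2)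
        with r1 Cut_sigma[of t d t2 d2 t1 l1] n c show ?thesis by auto
      qed
    next
      case r1: (beta t0 t1 u u1 l0 l1)
      from c2[unfolded c] show ?thesis
      proof (cases rule: par_CutE)
        case (cong t2 l2)
        with r1 Cut_beta[of t0 u l0 t1 u1 l1 t2 l2] n c show ?thesis by auto
      next
        case (beta t0' t2 u' u2 l0' l2)
        with r1 obtain t3 u3 l3 where "par_trm t1 t3" "par_trm u1 u3" "par_cotrm l1 l3"
          "par_trm t2 t3" "par_trm u2 u3" "par_cotrm l2 l3"
          using IHt[of t0 t1 t2] IHt[of u u1 u2] IHl[of l0 l1 l2] n c by auto
        with r1 beta show ?thesis
          by (intro exI[of _ "Cut u3 (Sel (Cut t3 (lift_cotrm 0 l3)))"])
            (auto intro!: par_Cut par_Sel par_lift)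
      qed (use r1 in auto)
    next
      case r1: (pi d d1 E1)
      from c2[unfolded c] show ?thesis
      proof (cases rule: par_CutE)
        case (cong t2 l2)
        with r1 Cut_pi[of d l d1 E1 t2 l2] n c show ?thesis by auto
      next
        case (pi d' d2 E2)
        with r1 obtain d3 E3 where "par_cmd d1 d3" "par_cmd d2 d3" "par_cotrm E1 E3" "par_cotrm E2 E3"
          using IHc[of d d1 d2] IHl[of l E1 E2] n c by auto
        with r1 pi show ?thesis by (blast intro: par_append eval_ctx_par)
      \<comment> \<open>An evaluation context is never a selection, so \<pi> and \<sigma> exclude
        each other at the root; \<beta> and \<pi> differ in the head term.\<close>
      qed (use r1 in \<open>auto simp: eval_ctx.simps\<close>)
    next
      case r1: (sigma t1 d d1)
      from c2[unfolded c] show ?thesis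
      proof (cases rule: par_CutE)
        case (cong t2 l2)
        with r1 Cut_sigma[of t d t1 d1 t2 l2] n c show ?thesis by auto
      next
        case (sigma t2 d' d2)
        with r1 obtain t3 d3 where "par_trm t1 t3" "par_trm t2 t3" "par_cmd d1 d3" "par_cmd d2 d3"
          using IHt[of t t1 t2] IHc[of d d1 d2] n c by auto
        with r1 sigma show ?thesis by (blast intro: par_subst)
      qed (use r1 in \<open>auto simp: eval_ctx.simps\<close>)
    qed
  qed

  from trm cotrm cmd show ?case by blast
qed

lemma par_diamond:
  "par_trm t t1 \<Longrightarrow> par_trm t t2 \<Longrightarrow> \<exists>t3. par_trm t1 t3 \<and> par_trm t2 t3"
  "par_cotrm l l1 \<Longrightarrow> par_cotrm l l2 \<Longrightarrow> \<exists>l3. par_cotrm l1 l3 \<and> par_cotrm l2 l3"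
  "par_cmd c c1 \<Longrightarrow> par_cmd c c2 \<Longrightarrow> \<exists>c3. par_cmd c1 c3 \<and> par_cmd c2 c3"
  using diamond_aux by blast+

section \<open>Comparison of parallel reduction with reduction\<close>

lemma red_imp_par:
  "red_trm t t' \<Longrightarrow> par_trm t t'"
  "red_cotrm l l' \<Longrightarrow> par_cotrm l l'"
  "red_cmd c c' \<Longrightarrow> par_cmd c c'"
proof (induction rule: red_trm_red_cotrm_red_cmd.inducts)
  case (pi E t l)
  then show ?case using par_pi[of E "Cut t l" "Cut t l" E] by simp
qed (auto intro: par_trm_par_cotrm_par_cmd.intros)

lemma rtranclp_image:
  assumes "r\<^sup>*\<^sup>* x y" and "\<And>x y. r x y \<Longrightarrow> s (f x) (f y)"
  shows "s\<^sup>*\<^sup>* (f x) (f y)"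
  using assms(1)
proof induction
  case (step y z)
  show ?case by (rule rtranclp.rtrancl_into_rtrancl[OF step.IH assms(2)[OF step.hyps(2)]])
qed simp

lemma reds_cong:
  "red_trm\<^sup>*\<^sup>* t t' \<Longrightarrow> red_trm\<^sup>*\<^sup>* (Lam t) (Lam t')"
  "red_cmd\<^sup>*\<^sup>* c c' \<Longrightarrow> red_trm\<^sup>*\<^sup>* (Coe c) (Coe c')"
  "red_cmd\<^sup>*\<^sup>* c c' \<Longrightarrow> red_cotrm\<^sup>*\<^sup>* (Sel c) (Sel c')"
  by (erule rtranclp_image, erule Lam Coe Sel)+

lemma reds_Push:
  assumes "red_trm\<^sup>*\<^sup>* u u'" "red_cotrm\<^sup>*\<^sup>* l l'"
  shows "red_cotrm\<^sup>*\<^sup>* (Push u l) (Push u' l')"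
  by (rule rtranclp_trans)
    (rule rtranclp_image[where f = "\<lambda>u. Push u l", OF assms(1)], erule Push_left,
      rule rtranclp_image[OF assms(2)], erule Push_right)

lemma reds_Cut:
  assumes "red_trm\<^sup>*\<^sup>* t t'" "red_cotrm\<^sup>*\<^sup>* l l'"
  shows "red_cmd\<^sup>*\<^sup>* (Cut t l) (Cut t' l')"
  by (rule rtranclp_trans)
    (rule rtranclp_image[where f = "\<lambda>t. Cut t l", OF assms(1)], erule Cut_left,
      rule rtranclp_image[OF assms(2)], erule Cut_right)

text \<open>For \<beta>, \<pi> and \<sigma> the parts are reduced first and the root is contracted
  last. For \<epsilon> and \<mu> the root comes first; for \<mu> this avoids reducing a lifted
  co-term.\<close>

lemma par_imp_reds:
  "par_trm t t' \<Longrightarrow> red_trm\<^sup>*\<^sup>* t t'"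
  "par_cotrm l l' \<Longrightarrow> red_cotrm\<^sup>*\<^sup>* l l'"
  "par_cmd c c' \<Longrightarrow> red_cmd\<^sup>*\<^sup>* c c'"
proof (induction rule: par_trm_par_cotrm_par_cmd.inducts)
  case (par_epsilon t t')
  show ?case by (rule converse_rtranclp_into_rtranclp[OF epsilon par_epsilon.IH])
next
  case (par_mu l l')
  show ?case by (rule converse_rtranclp_into_rtranclp[OF mu par_mu.IH])
next
  case (par_beta t t' u u' l l')
  then have "red_cmd\<^sup>*\<^sup>* (Cut (Lam t) (Push u l)) (Cut (Lam t') (Push u' l'))"
    by (intro reds_Cut reds_cong reds_Push)
  then show ?case by (rule rtranclp.rtrancl_into_rtrancl) (rule beta)
next
  case (par_pi E c c' E')
  then have "red_cmd\<^sup>*\<^sup>* (Cut (Coe c) E) (Cut (Coe c') E')"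
    by (intro reds_Cut reds_cong)
  moreover have "red_cmd (Cut (Coe c') E') (append_cmd c' E')"
    using pi[OF eval_ctx_par[OF par_pi.hyps(1,3)]] by (cases c') simp
  ultimately show ?case by (rule rtranclp.rtrancl_into_rtrancl)
next
  case (par_sigma t t' c c')
  then have "red_cmd\<^sup>*\<^sup>* (Cut t (Sel c)) (Cut t' (Sel c'))"
    by (intro reds_Cut reds_cong)
  then show ?case by (rule rtranclp.rtrancl_into_rtrancl) (rule sigma)
qed (auto intro: reds_cong reds_Push reds_Cut)

section \<open>Confluence\<close>

text \<open>Relations \<open>r\<close> and \<open>p\<close> with \<open>p\<close> between
  \<open>r\<close> and its reflexive transitive closure have the same closure, and confluence
  depends on the closure only. The diamond property of \<open>p\<close> is a special case of strong
  confluence.\<close>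

lemma confluentp_if_diamond_between:
  assumes diamond: "\<And>x y z. p x y \<Longrightarrow> p x z \<Longrightarrow> \<exists>w. p y w \<and> p z w"
    and sub: "\<And>x y. r x y \<Longrightarrow> p x y" and sup: "\<And>x y. p x y \<Longrightarrow> r\<^sup>*\<^sup>* x y"
  shows "confluentp r"
proof -
  have "strong_confluentp p"
    using diamond by (intro strong_confluentpI) (metis r_into_rtranclp sup2CI)
  then have "confluentp p"
    by (rule strong_confluentp_imp_confluentp)
  moreover have "p\<^sup>*\<^sup>* = r\<^sup>*\<^sup>*"
  proof (rule antisym)
    show "r\<^sup>*\<^sup>* \<le> p\<^sup>*\<^sup>*" using sub by (intro rtranclp_mono) blast
    have "p\<^sup>*\<^sup>* \<le> r\<^sup>*\<^sup>*\<^sup>*\<^sup>*" using sup by (intro rtranclp_mono) blast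
    then show "p\<^sup>*\<^sup>* \<le> r\<^sup>*\<^sup>*" by simp
  qed
  ultimately show ?thesis
    by (simp add: confluentp_conv_strong_confluentp_rtranclp)
qed

theorem theorem3p8:
  shows "(\<forall>t t1 t2. red_trm\<^sup>*\<^sup>* t t1 \<longrightarrow> red_trm\<^sup>*\<^sup>* t t2 \<longrightarrow>
           (\<exists>t3. red_trm\<^sup>*\<^sup>* t1 t3 \<and> red_trm\<^sup>*\<^sup>* t2 t3))
       \<and> (\<forall>l l1 l2. red_cotrm\<^sup>*\<^sup>* l l1 \<longrightarrow> red_cotrm\<^sup>*\<^sup>* l l2 \<longrightarrow>
           (\<exists>l3. red_cotrm\<^sup>*\<^sup>* l1 l3 \<and> red_cotrm\<^sup>*\<^sup>* l2 l3))
       \<and> (\<forall>c c1 c2. red_cmd\<^sup>*\<^sup>* c c1 \<longrightarrow> red_cmd\<^sup>*\<^sup>* c c2 \<longrightarrow>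
           (\<exists>c3. red_cmd\<^sup>*\<^sup>* c1 c3 \<and> red_cmd\<^sup>*\<^sup>* c2 c3))"
  using
    confluentpD[OF confluentp_if_diamond_between[OF par_diamond(1) red_imp_par(1) par_imp_reds(1)]]
    confluentpD[OF confluentp_if_diamond_between[OF par_diamond(2) red_imp_par(2) par_imp_reds(2)]]
    confluentpD[OF confluentp_if_diamond_between[OF par_diamond(3) red_imp_par(3) par_imp_reds(3)]]
  by (intro conjI allI impI)

end
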